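(* Let $D$ be a finite oriented graph whose missing graph is $S_x\cup S_y$, where $S_x$ and $S_y$ are stars with distinct centers $x\neq y$ (the two stars may be vertex-disjoint or may share vertices). Then $D$ has a vertex $v$ with $|N^+(v)|\le |N^{++}(v)|$.
   Context: An oriented graph is a finite digraph with no loops and at most one arc between any two vertices. $N^+(v)$ is the out-neighborhood of $v$, and the second out-neighborhood $N^{++}(v)$ is the set of vertices $w\notin N^+(v)\cup\{v\}$ such that $u\to w$ for some $u\in N^+(v)$. Two distinct vertices $u,v$ form a missing edge $uv$ if neither $(u,v)$ nor $(v,u)$ is an arc. The missing graph of $D$ is the graph whose edges are the missing edges of $D$ and whose vertices are the vertices incident to a missing edge. A star $S_x$ with center $x$ and leaves $a_1,\dots,a_k$ ($k\ge 0$) is the graph with vertex set $\{x,a_1,\dots,a_k\}$ and edges $a_ix$. *)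

theory Defs
  imports Main
begin

definition oriented_graph :: "'a set \<Rightarrow> ('a \<times> 'a) set \<Rightarrow> bool" where
  "oriented_graph V A \<longleftrightarrow> finite V \<and> A \<subseteq> V \<times> V \<and>
     (\<forall>v. (v, v) \<notin> A) \<and> (\<forall>u v. (u, v) \<in> A \<longrightarrow> (v, u) \<notin> A)"

definition out_nbhd :: "('a \<times> 'a) set \<Rightarrow> 'a \<Rightarrow> 'a set" where
  "out_nbhd A v = {w. (v, w) \<in> A}"

definition second_out_nbhd :: "('a \<times> 'a) set \<Rightarrow> 'a \<Rightarrow> 'a set" where
  "second_out_nbhd A v =
     {w. w \<notin> out_nbhd A v \<and> w \<noteq> v \<and> (\<exists>u \<in> out_nbhd A v. (u, w) \<in> A)}"

definition missing_edges :: "'a set \<Rightarrow> ('a \<times> 'a) set \<Rightarrow> 'a set set" where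
  "missing_edges V A = {{u, v} | u v. u \<in> V \<and> v \<in> V \<and> u \<noteq> v \<and>
                          (u, v) \<notin> A \<and> (v, u) \<notin> A}"

definition missing_graph :: "'a set \<Rightarrow> ('a \<times> 'a) set \<Rightarrow> 'a set \<times> 'a set set" where
  "missing_graph V A = (\<Union> (missing_edges V A), missing_edges V A)"

text \<open>Star with center x and leaf set L (x not a leaf).\<close>

definition star :: "'a \<Rightarrow> 'a set \<Rightarrow> 'a set \<times> 'a set set" where
  "star x L = (insert x L, {{a, x} | a. a \<in> L})"

definition graph_union :: "'a set \<times> 'a set set \<Rightarrow> 'a set \<times> 'a set set \<Rightarrow> 'a set \<times> 'a set set" where
  "graph_union G H = (fst G \<union> fst H, snd G \<union> snd H)"

end

theory Submission
  imports Defs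
begin

text \<open>
  Complete D to a tournament T and take a median order of T, i.e. one with as many forward arcs as
  possible; let f be its last vertex, the feed. Havet and Thomasse show that f has at least as
  many second out-neighbours in T as out-neighbours. Their argument works for every set N of
  out-neighbours of f: at least |N| vertices outside N are reached from N by a forward arc, and in
  the case of equality f dominates none of these, and they and N can be moved behind f without losing
  the median order (sedimentation). Taking for N the out-neighbourhood of f in D, only those second
  neighbours matter that are gained through a completing arc.

  By symmetry, y dominates x in T, either by an arc of D or by a convenient orientation of a missing
  edge; here (u, w) is convenient if every in-neighbour of u reaches w within two steps,
  so that adding it creates no second neighbours. Every other missing edge at y is
  directed into y, and a missing edge ax is directed (x, a) if this is convenient, else (a, x).
  Then a feed other than y gains at most y; the exceptions, which may gain x, can keep their
  arc to y as compensation. If the gain of y is decisive, sedimentation moves y closer to the end,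
  which is impossible if the median order was chosen with y as late as possible. Finally, the feed
  y gains at most x, which is not decisive because y dominates x in T.
\<close>

locale oriented_digraph =
  fixes V :: "'a set" and A :: "('a \<times> 'a) set"
  assumes oriented_graph: "oriented_graph V A"
begin

lemma finite_vertices: "finite V"
  and arcs_subset: "A \<subseteq> V \<times> V"
  and arcs_irrefl: "(v, v) \<notin> A"
  and arcs_asym: "(u, v) \<in> A \<Longrightarrow> (v, u) \<notin> A"
  using oriented_graph unfolding oriented_graph_def by auto

lemma finite_arcs: "finite A"
  using arcs_subset finite_vertices by (simp add: finite_subset)

lemma out_nbhd_subset: "out_nbhd A v \<subseteq> V"
  using arcs_subset unfolding out_nbhd_def by auto

lemma finite_out_nbhd: "finite (out_nbhd A v)"
  using out_nbhd_subset finite_vertices by (rule finite_subset)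

lemma mem_second_out_nbhd_iff: "w \<in> second_out_nbhd A v \<longleftrightarrow> (v, w) \<in> A O A \<and> (v, w) \<notin> A"
  using arcs_asym unfolding second_out_nbhd_def out_nbhd_def by auto

lemma finite_second_out_nbhd: "finite (second_out_nbhd A v)"
proof (rule finite_subset)
  show "second_out_nbhd A v \<subseteq> V"
    using arcs_subset by (auto simp: mem_second_out_nbhd_iff)
qed (rule finite_vertices)

definition surplus :: "'a \<Rightarrow> 'a set \<Rightarrow> int" where
  "surplus v C = int (card {c \<in> C. (v, c) \<in> A}) - int (card {c \<in> C. (c, v) \<in> A})"

lemma surplus_ge:
  assumes "X \<subseteq> out_nbhd A v" "finite Y"
  shows "int (card X) - int (card Y) \<le> surplus v (X \<union> Y)"
proof -
  have "finite X" using assms(1) finite_out_nbhd by (rule finite_subset)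
  then have "card X \<le> card {c \<in> X \<union> Y. (v, c) \<in> A}"
    using assms by (intro card_mono) (auto simp: out_nbhd_def)
  moreover have "card {c \<in> X \<union> Y. (c, v) \<in> A} \<le> card Y"
    using assms arcs_asym by (intro card_mono) (auto simp: out_nbhd_def)
  ultimately show ?thesis unfolding surplus_def by simp
qed

lemma surplus_gt:
  assumes "X \<subseteq> out_nbhd A v" "finite Y" "y \<in> Y" "y \<in> out_nbhd A v"
  shows "int (card X) - int (card Y) < surplus v (X \<union> Y)"
proof -
  have "int (card (insert y X)) - int (card (Y - {y})) \<le> surplus v (insert y X \<union> (Y - {y}))"
    using assms by (intro surplus_ge) auto
  moreover have "insert y X \<union> (Y - {y}) = X \<union> Y" using assms(3) by auto
  moreover have "card X \<le> card (insert y X)" by (rule card_insert_le)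
  moreover have "card (Y - {y}) < card Y" using assms(2,3) by (rule card_Diff1_less)
  ultimately show ?thesis by simp
qed

definition forward_arcs :: "('a \<Rightarrow> nat) \<Rightarrow> ('a \<times> 'a) set" where
  "forward_arcs r = {(u, v) \<in> A. r u < r v}"

lemma finite_forward_arcs: "finite (forward_arcs r)"
  unfolding forward_arcs_def by (rule finite_subset[OF _ finite_arcs]) auto

definition median_order :: "('a \<Rightarrow> nat) \<Rightarrow> bool" where
  "median_order r \<longleftrightarrow> inj_on r V \<and>
     (\<forall>r'. inj_on r' V \<longrightarrow> card (forward_arcs r') \<le> card (forward_arcs r))"

lemma median_orderD:
  assumes "median_order r"
  shows "inj_on r V" and "inj_on r' V \<Longrightarrow> card (forward_arcs r') \<le> card (forward_arcs r)"
  using assms unfolding median_order_def by auto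

lemma ex_median_order: "\<exists>r. median_order r"
proof -
  obtain r0 :: "'a \<Rightarrow> nat" where "inj_on r0 V"
    using finite_imp_inj_to_nat_seg[OF finite_vertices] by blast
  moreover have "\<forall>r. inj_on r V \<longrightarrow> card (forward_arcs r) < Suc (card A)"
    using finite_arcs by (auto simp: forward_arcs_def less_Suc_eq_le intro!: card_mono)
  ultimately show ?thesis
    unfolding median_order_def
    using ex_has_greatest_nat[of "\<lambda>r. inj_on r V" r0 "\<lambda>r. card (forward_arcs r)" "Suc (card A)"]
    by blast
qed

definition feed :: "('a \<Rightarrow> nat) \<Rightarrow> 'a \<Rightarrow> bool" where
  "feed r f \<longleftrightarrow> f \<in> V \<and> (\<forall>v \<in> V - {f}. r v < r f)"

lemma ex_feed:
  assumes "V \<noteq> {}" "inj_on r V"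
  shows "\<exists>f. feed r f"
proof -
  have "Max (r ` V) \<in> r ` V" using assms(1) finite_vertices by simp
  then obtain f where f: "f \<in> V" "r f = Max (r ` V)" by auto
  have "r v < r f" if "v \<in> V - {f}" for v
  proof -
    have "r v \<le> r f" using that f(2) finite_vertices by simp
    moreover have "r v \<noteq> r f" using that f(1) inj_onD[OF assms(2)] by blast
    ultimately show ?thesis by simp
  qed
  then show ?thesis using f(1) unfolding feed_def by blast
qed

definition raise :: "'a set \<Rightarrow> ('a \<Rightarrow> nat) \<Rightarrow> 'a \<Rightarrow> nat" where
  "raise S r v = (if v \<in> S then r v + Suc (Max (r ` V)) else r v)"

lemma raise_less_iff:
  assumes "u \<in> V" "v \<in> V"
  shows "raise S r u < raise S r v \<longleftrightarrow> (if u \<in> S \<longleftrightarrow> v \<in> S then r u < r v else v \<in> S)"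
proof -
  have "r u \<le> Max (r ` V)" "r v \<le> Max (r ` V)" using assms finite_vertices by auto
  then show ?thesis unfolding raise_def by auto
qed

lemma inj_on_raise:
  assumes "inj_on r V"
  shows "inj_on (raise S r) V"
proof (rule inj_onI)
  fix u v assume uv: "u \<in> V" "v \<in> V" "raise S r u = raise S r v"
  then have "r u = r v"
    using raise_less_iff[OF uv(1,2), of S r] raise_less_iff[OF uv(2,1), of S r]
    by (auto split: if_splits)
  then show "u = v" using uv(1,2) inj_onD[OF assms] by blast
qed

definition later :: "('a \<Rightarrow> nat) \<Rightarrow> 'a \<Rightarrow> 'a set" where
  "later r v = {u \<in> V. r v < r u}"

lemma card_later_raise_less:
  assumes "feed r f" "f \<notin> S" "z \<in> S" "z \<in> V"
  shows "card (later (raise S r) z) < card (later r z)"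
proof (rule psubset_card_mono)
  show "finite (later r z)" using finite_vertices unfolding later_def by simp
  have "f \<in> later r z" using assms unfolding feed_def later_def by auto
  moreover have "f \<notin> later (raise S r) z" "later (raise S r) z \<subseteq> later r z"
    using assms by (auto simp: later_def feed_def raise_less_iff split: if_splits)
  ultimately show "later (raise S r) z \<subset> later r z" by blast
qed

lemma forward_arcs_raise:
  assumes "inj_on r V" "S \<subseteq> V"
  shows "forward_arcs (raise S r) - forward_arcs r =
      (SIGMA m : V - S. {c \<in> {c \<in> S. r c < r m}. (m, c) \<in> A})" (is ?gained)
    and "forward_arcs r - forward_arcs (raise S r) =
      (SIGMA m : V - S. {c \<in> {c \<in> S. r c < r m}. (c, m) \<in> A})\<inverse>" (is ?lost)
proof -
  have in_V: "u \<in> V" "v \<in> V" if "(u, v) \<in> A" for u v using that arcs_subset by auto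
  have distinct_ranks: "r u \<noteq> r v" if "(u, v) \<in> A" for u v
    using that in_V[OF that] arcs_irrefl inj_onD[OF assms(1)] by metis
  have raised: "(u, v) \<in> forward_arcs (raise S r) \<longleftrightarrow>
      (u, v) \<in> A \<and> (if u \<in> S \<longleftrightarrow> v \<in> S then r u < r v else v \<in> S)" for u v
    using in_V raise_less_iff[of u v S r] unfolding forward_arcs_def by auto
  have "(m, c) \<in> forward_arcs (raise S r) - forward_arcs r \<longleftrightarrow>
      m \<in> V - S \<and> c \<in> S \<and> r c < r m \<and> (m, c) \<in> A" for m c
    using distinct_ranks[of m c] in_V[of m c]
    unfolding Diff_iff raised by (auto simp: forward_arcs_def)
  then show ?gained by auto
  have "(c, m) \<in> forward_arcs r - forward_arcs (raise S r) \<longleftrightarrow>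
      m \<in> V - S \<and> c \<in> S \<and> r c < r m \<and> (c, m) \<in> A" for m c
    using in_V[of c m] unfolding Diff_iff raised by (auto simp: forward_arcs_def)
  then show ?lost by auto
qed

lemma card_forward_arcs_raise:
  assumes "inj_on r V" "S \<subseteq> V"
  shows "int (card (forward_arcs (raise S r))) =
    int (card (forward_arcs r)) + (\<Sum>m \<in> V - S. surplus m {c \<in> S. r c < r m})"
proof -
  let ?F = "forward_arcs r" and ?F' = "forward_arcs (raise S r)"
  have "finite S" using assms(2) finite_vertices by (rule finite_subset)
  then have "card (?F' - ?F) = (\<Sum>m \<in> V - S. card {c \<in> {c \<in> S. r c < r m}. (m, c) \<in> A})"
    and "card (?F - ?F') = (\<Sum>m \<in> V - S. card {c \<in> {c \<in> S. r c < r m}. (c, m) \<in> A})"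
    using finite_vertices by (simp_all add: forward_arcs_raise[OF assms] card_inverse)
  moreover have "card ?F' + card (?F - ?F') = card ?F + card (?F' - ?F)"
    using card_Un_disjoint[of ?F' "?F - ?F'"] card_Un_disjoint[of ?F "?F' - ?F"]
      finite_forward_arcs by (simp add: Un_commute)
  ultimately show ?thesis
    unfolding surplus_def sum_subtractf by (simp flip: of_nat_sum)
qed

definition forward_nbhd :: "('a \<Rightarrow> nat) \<Rightarrow> 'a set \<Rightarrow> 'a set" where
  "forward_nbhd r N = forward_arcs r `` N - N"

lemma forward_nbhd_subset: "forward_nbhd r N \<subseteq> A `` N - N"
  unfolding forward_nbhd_def forward_arcs_def by auto

lemma finite_forward_nbhd: "finite (forward_nbhd r N)"
proof (rule finite_subset)
  show "forward_nbhd r N \<subseteq> V" using forward_nbhd_subset[of r N] arcs_subset by blast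
qed (rule finite_vertices)

definition tail :: "('a \<Rightarrow> nat) \<Rightarrow> 'a set \<Rightarrow> nat \<Rightarrow> 'a set" where
  "tail r N t = {c \<in> N \<union> forward_nbhd r N. t \<le> r c}"

definition balance :: "('a \<Rightarrow> nat) \<Rightarrow> 'a set \<Rightarrow> nat \<Rightarrow> int" where
  "balance r N t = int (card {c \<in> N. t \<le> r c}) - int (card {c \<in> forward_nbhd r N. t \<le> r c})"

lemma tail_0: "tail r N 0 = N \<union> forward_nbhd r N"
  unfolding tail_def by auto

lemma balance_0: "balance r N 0 = int (card N) - int (card (forward_nbhd r N))"
  unfolding balance_def by simp

lemma tail_subset: "N \<subseteq> V \<Longrightarrow> tail r N t \<subseteq> V"
  using forward_nbhd_subset[of r N] arcs_subset unfolding tail_def by blast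

lemma balance_diff:
  assumes "finite N"
  shows "balance r N t - balance r N (max t k) =
    int (card {c \<in> N. t \<le> r c \<and> r c < k}) - int (card {c \<in> forward_nbhd r N. t \<le> r c \<and> r c < k})"
proof -
  have "card {c \<in> B. t \<le> r c} = card {c \<in> B. t \<le> r c \<and> r c < k} + card {c \<in> B. max t k \<le> r c}"
    if "finite B" for B
  proof -
    have "{c \<in> B. t \<le> r c} = {c \<in> B. t \<le> r c \<and> r c < k} \<union> {c \<in> B. max t k \<le> r c}" by auto
    then show ?thesis using that by (simp add: card_Un_disjoint disjoint_iff)
  qed
  from this[OF assms] this[OF finite_forward_nbhd[of r N]] show ?thesis
    unfolding balance_def by simp
qed

lemma notin_tail_if_dominates:
  assumes "N \<subseteq> out_nbhd A f"
  shows "f \<notin> tail r N t"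
  using assms arcs_irrefl arcs_asym
  unfolding tail_def forward_nbhd_def forward_arcs_def out_nbhd_def by auto

lemma balance_le_surplus_tail:
  assumes "N \<subseteq> out_nbhd A f"
  shows "balance r N t \<le> surplus f (tail r N t)"
proof -
  have "tail r N t = {c \<in> N. t \<le> r c} \<union> {c \<in> forward_nbhd r N. t \<le> r c}"
    unfolding tail_def by auto
  then show ?thesis
    using surplus_ge[of "{c \<in> N. t \<le> r c}" f "{c \<in> forward_nbhd r N. t \<le> r c}"]
      assms finite_forward_nbhd unfolding balance_def by auto
qed

lemma ex_max_balance:
  assumes "finite N"
  obtains t where "\<And>t'. balance r N t' \<le> balance r N t"
proof -
  let ?G = "forward_nbhd r N"
  have "balance r N t \<in> {- int (card ?G)..int (card N)}" for t
  proof -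
    have "card {c \<in> N. t \<le> r c} \<le> card N" "card {c \<in> ?G. t \<le> r c} \<le> card ?G"
      using assms finite_forward_nbhd by (auto intro: card_mono)
    then show ?thesis unfolding balance_def by simp
  qed
  then have "range (balance r N) \<subseteq> {- int (card ?G)..int (card N)}" by blast
  then have finite_range: "finite (range (balance r N))" by (rule finite_subset) simp
  then have "Max (range (balance r N)) \<in> range (balance r N)" by (rule Max_in) simp
  then obtain t where "balance r N t = Max (range (balance r N))" by (metis imageE)
  then show thesis using finite_range by (intro that[of t]) simp
qed

end

locale tournament = oriented_digraph V T for V :: "'a set" and T :: "('a \<times> 'a) set" +
  assumes total_on: "total_on V T"
begin

text \<open>A vertex m outside N that no forward arc from N enters dominates every earlier vertex of N.\<close>

lemma surplus_tail_ge:
  assumes "N \<subseteq> V" "m \<in> V" "m \<notin> tail r N t"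
  shows "balance r N t - balance r N (max t (r m)) \<le> surplus m {c \<in> tail r N t. r c < r m}"
proof -
  let ?X = "{c \<in> N. t \<le> r c \<and> r c < r m}"
  have "?X \<subseteq> out_nbhd T m"
  proof
    fix c assume c_in: "c \<in> ?X"
    then have "m \<notin> N \<union> forward_nbhd r N" using assms(3) unfolding tail_def by auto
    then have "(c, m) \<notin> T" "c \<noteq> m" using c_in unfolding forward_nbhd_def forward_arcs_def by auto
    then show "c \<in> out_nbhd T m"
      using total_on c_in assms(1,2) unfolding total_on_def out_nbhd_def by blast
  qed
  then have "int (card ?X) - int (card {c \<in> forward_nbhd r N. t \<le> r c \<and> r c < r m})
      \<le> surplus m (?X \<union> {c \<in> forward_nbhd r N. t \<le> r c \<and> r c < r m})"
    using finite_forward_nbhd by (intro surplus_ge) auto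
  moreover have "?X \<union> {c \<in> forward_nbhd r N. t \<le> r c \<and> r c < r m} = {c \<in> tail r N t. r c < r m}"
    unfolding tail_def by auto
  ultimately show ?thesis
    unfolding balance_diff[OF finite_subset[OF assms(1) finite_vertices]] by (simp only:)
qed

text \<open>In a median order the vertices passed by a raised tail have nonpositive total surplus. If the
  balance of the tail is maximal, then only the feed can have negative surplus, so even this
  maximum is nonpositive.\<close>

lemma card_forward_arcs_raise_tail:
  assumes "inj_on r V" "feed r f" "N \<subseteq> out_nbhd T f"
    and maximal: "\<And>t'. balance r N t' \<le> balance r N t"
  shows "int (card (forward_arcs r)) + surplus f (tail r N t)
    \<le> int (card (forward_arcs (raise (tail r N t) r)))"
proof -
  let ?S = "tail r N t"
  have N_subset: "N \<subseteq> V" using assms(3) out_nbhd_subset by blast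
  have f_passed: "f \<in> V - ?S"
    using assms(2) notin_tail_if_dominates[OF assms(3)] unfolding feed_def by auto
  have "c \<noteq> f" "c \<in> V" if "c \<in> ?S" for c using that f_passed tail_subset[OF N_subset] by auto
  then have "{c \<in> ?S. r c < r f} = ?S" using assms(2) unfolding feed_def by auto
  moreover have "0 \<le> surplus m {c \<in> ?S. r c < r m}" if "m \<in> V - ?S" for m
    using surplus_tail_ge[OF N_subset, of m r t] maximal[of "max t (r m)"] that by simp
  ultimately have "surplus f ?S \<le> (\<Sum>m \<in> V - ?S. surplus m {c \<in> ?S. r c < r m})"
    using member_le_sum[OF f_passed, of "\<lambda>m. surplus m {c \<in> ?S. r c < r m}"] finite_vertices by simp
  then show ?thesis using card_forward_arcs_raise[OF assms(1) tail_subset[OF N_subset]] by simp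
qed

lemma surplus_feed_tail_le_0:
  assumes "median_order r" "feed r f" "N \<subseteq> out_nbhd T f"
    and "\<And>t'. balance r N t' \<le> balance r N t"
  shows "surplus f (tail r N t) \<le> 0"
proof -
  note inj = median_orderD(1)[OF assms(1)]
  have "card (forward_arcs (raise (tail r N t) r)) \<le> card (forward_arcs r)"
    using median_orderD(2)[OF assms(1) inj_on_raise[OF inj]] .
  then show ?thesis using card_forward_arcs_raise_tail[OF inj assms(2-4)] by simp
qed

lemma balance_le_0:
  assumes "median_order r" "feed r f" "N \<subseteq> out_nbhd T f"
  shows "balance r N t \<le> 0"
proof -
  have "finite N" using assms(3) finite_out_nbhd by (rule finite_subset)
  then obtain t0 where "\<And>t'. balance r N t' \<le> balance r N t0" using ex_max_balance by blast
  then show ?thesis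
    using surplus_feed_tail_le_0[OF assms] balance_le_surplus_tail[OF assms(3)]
    by (meson order_trans)
qed

lemma card_le_card_forward_nbhd:
  assumes "median_order r" "feed r f" "N \<subseteq> out_nbhd T f"
  shows "card N \<le> card (forward_nbhd r N)"
  using balance_le_0[OF assms, of 0] by (simp add: balance_0)

lemma sedimentation:
  assumes "median_order r" "feed r f" "N \<subseteq> out_nbhd T f"
    and cards_eq: "card N = card (forward_nbhd r N)"
  shows "median_order (raise (N \<union> forward_nbhd r N) r)"
    and "out_nbhd T f \<inter> forward_nbhd r N = {}"
proof -
  have balance_eq_0: "balance r N 0 = 0" by (simp add: balance_0 cards_eq)
  then have maximal: "balance r N t \<le> balance r N 0" for t
    using balance_le_0[OF assms(1-3)] by simp
  note inj = median_orderD(1)[OF assms(1)]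
  have "0 \<le> surplus f (tail r N 0)"
    using balance_le_surplus_tail[OF assms(3), of r 0] balance_eq_0 by simp
  then have "card (forward_arcs r) \<le> card (forward_arcs (raise (N \<union> forward_nbhd r N) r))"
    using card_forward_arcs_raise_tail[OF inj assms(2,3) maximal] by (simp add: tail_0)
  then show "median_order (raise (N \<union> forward_nbhd r N) r)"
    using assms(1) inj_on_raise[OF inj] unfolding median_order_def by (meson le_trans)
  show "out_nbhd T f \<inter> forward_nbhd r N = {}"
    using surplus_gt[OF assms(3) finite_forward_nbhd, of _ r] cards_eq
      surplus_feed_tail_le_0[OF assms(1-3) maximal] by (force simp: tail_0)
qed

lemma card_le_Suc_card:
  assumes "median_order r" "feed r f" "N \<subseteq> out_nbhd T f"
    and "T `` N - N \<subseteq> insert z Z" "finite Z"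
  shows "card N \<le> Suc (card Z)"
proof -
  have "card (forward_nbhd r N) \<le> card (insert z Z)"
    using forward_nbhd_subset[of r N] assms(4,5) by (intro card_mono) auto
  also have "\<dots> \<le> Suc (card Z)" by (rule card_insert_le_m1) simp_all
  finally show ?thesis using card_le_card_forward_nbhd[OF assms(1-3)] by simp
qed

lemma card_le_or_sediment:
  assumes "median_order r" "feed r f" "N \<subseteq> out_nbhd T f"
    and "T `` N - N \<subseteq> insert z Z" "finite Z"
  obtains (card_le) "card N \<le> card Z"
  | (sediment) r' where "median_order r'" "card (later r' z) < card (later r z)" "(f, z) \<notin> T"
proof (cases "card N \<le> card Z")
  case False
  let ?G = "forward_nbhd r N"
  have N_le_G: "card N \<le> card ?G" by (rule card_le_card_forward_nbhd[OF assms(1-3)])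
  have "?G - {z} \<subseteq> Z" using forward_nbhd_subset[of r N] assms(4) by blast
  then have "card (?G - {z}) \<le> card Z" using assms(5) by (rule card_mono[rotated])
  then have z_in_G: "z \<in> ?G" and cards_eq: "card N = card ?G"
    using False N_le_G by (auto simp: card_Diff_singleton_if split: if_splits)
  show thesis
  proof (rule sediment)
    show "median_order (raise (N \<union> ?G) r)" by (rule sedimentation(1)[OF assms(1-3) cards_eq])
    show "(f, z) \<notin> T"
      using sedimentation(2)[OF assms(1-3) cards_eq] z_in_G unfolding out_nbhd_def by auto
    have "f \<notin> N \<union> ?G" using notin_tail_if_dominates[OF assms(3), of r 0] by (simp add: tail_0)
    moreover have "z \<in> V" using z_in_G forward_nbhd_subset[of r N] arcs_subset by blast
    ultimately show "card (later (raise (N \<union> ?G) r) z) < card (later r z)"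
      using card_later_raise_less[OF assms(2)] z_in_G by simp
  qed
qed (rule card_le)

end

context oriented_digraph
begin

lemma mem_missing_edges_iff:
  "{u, v} \<in> missing_edges V A \<longleftrightarrow> u \<in> V \<and> v \<in> V \<and> u \<noteq> v \<and> (u, v) \<notin> A \<and> (v, u) \<notin> A"
  unfolding missing_edges_def by (auto simp: doubleton_eq_iff)

definition within_two :: "('a \<times> 'a) set" where
  "within_two = A \<union> A O A"

definition convenient :: "'a \<Rightarrow> 'a \<Rightarrow> bool" where
  "convenient u w \<longleftrightarrow> (\<forall>v. (v, u) \<in> A \<longrightarrow> (v, w) \<in> within_two)"

lemma missing_edge_if_unreached:
  assumes "(v, a) \<in> A" "(v, b) \<notin> within_two"
    and "(w, b) \<in> A" "(w, a) \<notin> within_two"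
  shows "{v, w} \<in> missing_edges V A"
  using assms arcs_subset unfolding within_two_def mem_missing_edges_iff by blast

end

locale two_stars = oriented_digraph V A for V :: "'a set" and A :: "('a \<times> 'a) set" +
  fixes x y :: 'a
  assumes centers: "x \<in> V" "y \<in> V" "x \<noteq> y"
    and center_of_missing_edge:
      "{u, v} \<in> missing_edges V A \<Longrightarrow> u = x \<or> u = y \<or> v = x \<or> v = y"
begin

definition completion :: "('a \<times> 'a) set" where
  "completion = A \<union> {(u, v). {u, v} \<in> missing_edges V A \<and>
     (u = y \<and> v = x \<or> v = y \<and> u \<noteq> x \<or>
      u = x \<and> v \<noteq> y \<and> convenient x v \<or> v = x \<and> u \<noteq> y \<and> \<not> convenient x u)}"

lemma arcs_subset_completion: "A \<subseteq> completion"
  unfolding completion_def by auto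

lemma completion_iff_converse:
  assumes "u \<in> V" "v \<in> V" "u \<noteq> v"
  shows "(u, v) \<in> completion \<longleftrightarrow> (v, u) \<notin> completion"
proof (cases "{u, v} \<in> missing_edges V A")
  case True
  then have "{v, u} \<in> missing_edges V A" "(u, v) \<notin> A" "(v, u) \<notin> A"
    unfolding mem_missing_edges_iff by auto
  then show ?thesis
    using True assms(3) centers(3) center_of_missing_edge[OF True] unfolding completion_def by auto
next
  case False
  then show ?thesis
    using assms arcs_asym unfolding completion_def mem_missing_edges_iff by auto
qed

sublocale completion: tournament V completion
proof
  have subset: "completion \<subseteq> V \<times> V"
    using arcs_subset unfolding completion_def mem_missing_edges_iff by auto
  have irrefl: "(v, v) \<notin> completion" for v
    using arcs_irrefl unfolding completion_def mem_missing_edges_iff by auto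
  show "oriented_graph V completion"
    unfolding oriented_graph_def
    using subset irrefl completion_iff_converse finite_vertices by blast
  show "total_on V completion"
    unfolding total_on_def using completion_iff_converse by blast
qed

lemma center_convenient:
  assumes "{x, y} \<in> missing_edges V A"
  shows "convenient x y \<or> convenient y x"
proof (rule ccontr)
  assume "\<not> (convenient x y \<or> convenient y x)"
  then obtain v w where "(v, x) \<in> A" "(v, y) \<notin> within_two" "(w, y) \<in> A" "(w, x) \<notin> within_two"
    unfolding convenient_def by blast
  then show False
    using center_of_missing_edge[OF missing_edge_if_unreached, of v x y w] assms arcs_irrefl
    unfolding mem_missing_edges_iff by blast
qed

context
  assumes not_xy: "(x, y) \<notin> A"
    and yx_convenient: "{x, y} \<in> missing_edges V A \<Longrightarrow> convenient y x"
begin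

lemma yx_in_completion: "(y, x) \<in> completion"
  using not_xy centers unfolding completion_def mem_missing_edges_iff by auto

lemma completion_cases:
  assumes "(u, w) \<in> completion"
  obtains (arc) "(u, w) \<in> A" | (into_y) "w = y" | (convenient) "convenient u w"
  | (inconvenient) "w = x" "{u, x} \<in> missing_edges V A" "\<not> convenient x u"
  using assms yx_convenient unfolding completion_def by (auto simp: insert_commute)

text \<open>If (y, x) is an arc, it keeps (x, a) from being convenient, so f may gain x through (a, x).\<close>

definition exceptional :: "'a \<Rightarrow> bool" where
  "exceptional f \<longleftrightarrow> {f, y} \<in> missing_edges V A \<and>
     (\<exists>a. (f, a) \<in> A \<and> {a, x} \<in> missing_edges V A \<and> (y, a) \<notin> within_two)"

lemma gained_second_neighbour:
  assumes "(f, u) \<in> A" "(u, w) \<in> completion" "w \<noteq> y" "(f, w) \<notin> within_two"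
  shows "w = x \<and> (f = y \<or> exceptional f)"
  using assms(2)
proof (cases rule: completion_cases)
  case inconvenient
  then obtain g where unreached: "(g, x) \<in> A" "(g, u) \<notin> within_two"
    unfolding convenient_def by blast
  have missing: "{f, g} \<in> missing_edges V A"
    using missing_edge_if_unreached[OF assms(1) _ unreached] assms(4) inconvenient(1) by blast
  moreover have "f \<noteq> x" "g \<noteq> x"
    using assms(1) inconvenient(2) unreached(1) arcs_irrefl unfolding mem_missing_edges_iff by auto
  ultimately have "f = y \<or> g = y" using center_of_missing_edge by blast
  then show ?thesis
    using missing assms(1) inconvenient(1,2) unreached(2)
    unfolding exceptional_def by blast
qed (use assms in \<open>auto simp: convenient_def within_two_def\<close>)

lemma completion_Image_y:
  "completion `` out_nbhd A y - out_nbhd A y \<subseteq> insert x (second_out_nbhd A y)"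
proof
  fix w assume "w \<in> completion `` out_nbhd A y - out_nbhd A y"
  then obtain u where path: "(y, u) \<in> A" "(u, w) \<in> completion" "(y, w) \<notin> A"
    unfolding out_nbhd_def by auto
  then have "w \<noteq> y" using arcs_subset_completion completion.arcs_asym by blast
  then show "w \<in> insert x (second_out_nbhd A y)"
    using gained_second_neighbour[OF path(1,2)] path(3) mem_second_out_nbhd_iff
    unfolding within_two_def by blast
qed

lemma completion_Image_not_exceptional:
  assumes "f \<noteq> y" "\<not> exceptional f"
  shows "completion `` out_nbhd A f - out_nbhd A f \<subseteq> insert y (second_out_nbhd A f)"
  using gained_second_neighbour[of f] assms mem_second_out_nbhd_iff
  unfolding out_nbhd_def within_two_def by blast

lemma completion_Image_exceptional:
  assumes "exceptional f"
  defines "N \<equiv> insert y (out_nbhd A f)"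
  shows "completion `` N - N \<subseteq> insert x (second_out_nbhd A f)"
proof
  fix w assume "w \<in> completion `` N - N"
  then obtain u where w_new: "w \<noteq> y" "(f, w) \<notin> A"
    and path: "u = y \<or> (f, u) \<in> A" "(u, w) \<in> completion"
    unfolding N_def out_nbhd_def by auto
  have "(f, w) \<in> A O A" if "w \<noteq> x"
  proof (cases "u = y")
    case True
    obtain a where unreached: "(f, a) \<in> A" "{a, x} \<in> missing_edges V A" "(y, a) \<notin> within_two"
      using assms(1) unfolding exceptional_def by blast
    have "a \<noteq> y" "a \<noteq> x"
      using unreached assms(1) unfolding exceptional_def mem_missing_edges_iff by auto
    then have "{a, w} \<notin> missing_edges V A" using center_of_missing_edge w_new(1) that by blast
    moreover have yw: "(y, w) \<in> A"
      using path(2) True w_new(1) that centers(3) unfolding completion_def by auto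
    then have "(w, a) \<notin> A" "w \<noteq> a" using unreached(3) unfolding within_two_def by auto
    ultimately have "(a, w) \<in> A"
      using yw unreached(1) arcs_subset unfolding mem_missing_edges_iff by blast
    then show ?thesis using unreached(1) by blast
  next
    case False
    then show ?thesis using gained_second_neighbour path w_new that
      unfolding within_two_def by blast
  qed
  then show "w \<in> insert x (second_out_nbhd A f)"
    using w_new(2) mem_second_out_nbhd_iff by blast
qed

lemma card_out_nbhd_le_exceptional:
  assumes "completion.median_order r" "completion.feed r f" "exceptional f"
  shows "card (out_nbhd A f) \<le> card (second_out_nbhd A f)"
proof -
  let ?N = "insert y (out_nbhd A f)"
  have "f \<noteq> x" "(f, y) \<notin> A" "{f, y} \<in> missing_edges V A"
    using assms(3) unfolding exceptional_def mem_missing_edges_iff by auto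
  then have "?N \<subseteq> out_nbhd completion f"
    using arcs_subset_completion unfolding out_nbhd_def completion_def by auto
  then have "card ?N \<le> Suc (card (second_out_nbhd A f))"
    using completion_Image_exceptional[OF assms(3)] finite_second_out_nbhd
    by (rule completion.card_le_Suc_card[OF assms(1,2)])
  then show ?thesis
    using \<open>(f, y) \<notin> A\<close> finite_out_nbhd by (simp add: out_nbhd_def)
qed

lemma ex_second_nbhd_vertex: "\<exists>v \<in> V. card (out_nbhd A v) \<le> card (second_out_nbhd A v)"
proof -
  obtain r where med: "completion.median_order r" and least:
    "\<And>r'. completion.median_order r' \<Longrightarrow> card (completion.later r y) \<le> card (completion.later r' y)"
    using completion.ex_median_order
      ex_has_least_nat[of completion.median_order _ "\<lambda>r. card (completion.later r y)"] by blast
  obtain f where feed: "completion.feed r f"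
    using completion.ex_feed centers(1) completion.median_orderD(1)[OF med] by blast
  have out_nbhd_mono: "out_nbhd A f \<subseteq> out_nbhd completion f"
    using arcs_subset_completion unfolding out_nbhd_def by auto
  note card_le_or_sediment =
    completion.card_le_or_sediment[OF med feed out_nbhd_mono _ finite_second_out_nbhd[of f]]
  consider (exceptional) "exceptional f" | (feed_y) "f = y"
    | (ordinary) "f \<noteq> y" "\<not> exceptional f" by blast
  then have "card (out_nbhd A f) \<le> card (second_out_nbhd A f)"
  proof cases
    case exceptional
    then show ?thesis by (rule card_out_nbhd_le_exceptional[OF med feed])
  next
    case feed_y
    then have "completion `` out_nbhd A f - out_nbhd A f \<subseteq> insert x (second_out_nbhd A f)"
      using completion_Image_y by simp
    then show ?thesis by (rule card_le_or_sediment) (use feed_y yx_in_completion in auto)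
  next
    case ordinary
    then have "completion `` out_nbhd A f - out_nbhd A f \<subseteq> insert y (second_out_nbhd A f)"
      by (rule completion_Image_not_exceptional)
    then show ?thesis by (rule card_le_or_sediment) (use least in \<open>auto simp: leD\<close>)
  qed
  then show ?thesis using feed unfolding completion.feed_def by blast
qed

end

end

lemma two_starsI:
  assumes "oriented_graph V A" "x \<noteq> y"
    and "missing_graph V A = graph_union (star x Lx) (star y Ly)"
  shows "two_stars V A x y"
proof -
  interpret oriented_digraph V A by standard (rule assms(1))
  have vertices: "\<Union> (missing_edges V A) = insert x Lx \<union> insert y Ly"
    and edges: "missing_edges V A = {{a, x} | a. a \<in> Lx} \<union> {{a, y} | a. a \<in> Ly}"
    using assms(3)
    unfolding missing_graph_def graph_union_def star_def fst_conv snd_conv prod.inject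
    by (rule conjunct1, rule conjunct2)
  have "\<Union> (missing_edges V A) \<subseteq> V" unfolding missing_edges_def by auto
  then have "x \<in> V" "y \<in> V" unfolding vertices by auto
  moreover have "u = x \<or> u = y \<or> v = x \<or> v = y" if "{u, v} \<in> missing_edges V A" for u v
    using that unfolding edges by (auto simp: doubleton_eq_iff)
  ultimately show ?thesis using assms(2) by unfold_locales
qed

lemma two_stars_commute: "two_stars V A x y \<Longrightarrow> two_stars V A y x"
  unfolding two_stars_def two_stars_axioms_def by blast

theorem theorem3p1:
  fixes V :: "'a set" and A :: "('a \<times> 'a) set" and x y :: 'a and Lx Ly :: "'a set"
  assumes "oriented_graph V A"
    and "finite Lx" and "finite Ly"
    and "x \<notin> Lx" and "y \<notin> Ly"
    and "x \<noteq> y"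
    and "missing_graph V A = graph_union (star x Lx) (star y Ly)"
  shows "\<exists>v \<in> V. card (out_nbhd A v) \<le> card (second_out_nbhd A v)"
proof -
  interpret xy: two_stars V A x y by (rule two_starsI[OF assms(1,6,7)])
  interpret yx: two_stars V A y x by (rule two_stars_commute[OF xy.two_stars_axioms])
  consider (y_first) "(x, y) \<notin> A" "{x, y} \<in> missing_edges V A \<Longrightarrow> xy.convenient y x"
    | (x_first) "(y, x) \<notin> A" "{y, x} \<in> missing_edges V A \<Longrightarrow> xy.convenient x y"
    using xy.center_convenient xy.arcs_asym unfolding xy.mem_missing_edges_iff by blast
  then show ?thesis
  proof cases
    case y_first
    then show ?thesis by (rule xy.ex_second_nbhd_vertex)
  next
    case x_first
    then show ?thesis by (rule yx.ex_second_nbhd_vertex)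
  qed
qed

end
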